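(* (Left maximization principle.) Let $Q$ be a bounded open subset of $\mathbb R^d$ and let $v:[0,T]\times\mathcal D\times[0,T]\times\mathcal D\to\mathbb R$ be continuous. Suppose there are a constant $L>0$ and an integer $k>0$ such that for all $t,s\in[0,T]$ and $x,x_1,x_2,y,y_1,y_2\in\mathcal D$, $$|v(t,x,s,y)|\le L(1+|x|_H+|x(0)|+|y|_H+|y(0)|)^k,$$ $$|v(t,x_1,s,y_1)-v(t,x_2,s,y_2)|\le L(|x_1-x_2|_H+|x_1(0)-x_2(0)|+|y_1-y_2|_H+|y_1(0)-y_2(0)|)^k.$$ Then for each $(t_0,x_0,s_0,y_0)\in[0,T]\times\mathcal D_{\bar Q}\times[0,T]\times\mathcal D_{\bar Q}$ there exists $(\bar t,\bar x,\bar s,\bar y)\in[t_0,T]\times\mathcal D_{\bar Q}\times[s_0,T]\times\mathcal D_{\bar Q}$ such that $$(\bar t,\bar x,\bar s,\bar y)=(t_0,x_0,s_0,y_0)\otimes(\bar t,\bar x,\bar s,\bar y),\qquad v(\bar t,\bar x,\bar s,\bar y)\ge v(t_0,x_0,s_0,y_0),$$ and $$v(\bar t,\bar x,\bar s,\bar y)=\sup_{(t,x,s,y)\in[\bar t,T]\times\mathcal D_{\bar Q}\times[\bar s,T]\times\mathcal D_{\bar Q}}v\big((\bar t,\bar x,\bar s,\bar y)\otimes(t,x,s,y)\big).$$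
   Context: Fix $T>0$, $\tau>0$, $d\ge1$. $\mathcal D$ is the Banach space of bounded right-continuous functions $[-\tau,0]\to\mathbb R^d$ with norm $|\omega|_{\mathcal D}=\sup_{\theta\in[-\tau,0]}|\omega(\theta)|$. $H=L^2([-\tau,0];\mathbb R^d)$ with norm $|\cdot|_H$. For open $Q\subset\mathbb R^d$, $\bar Q=Q\cup\partial Q$ and $\mathcal D_{\bar Q}=\{\omega\in\mathcal D:\omega(\theta)\in\bar Q\text{ for all }\theta\in[-\tau,0]\}$. For $0\le t\le\bar t\le T$, $0\le s\le\bar s\le T$ and $\omega,\bar\omega,\nu,\bar\nu\in\mathcal D$, define $(t,\omega,s,\nu)\otimes(\bar t,\bar\omega,\bar s,\bar\nu):=(\bar t,\tilde\omega,\bar s,\tilde\nu)$, where $\tilde\omega(\theta)=\bar\omega(\theta)$ if $\theta\in[-\tau,0]$, $t-\bar t\le\theta\le0$, and $\tilde\omega(\theta)=\omega(\bar t-t+\theta)$ if $-\tau\le\theta<t-\bar t$; and $\tilde\nu(\theta)=\bar\nu(\theta)$ if $\theta\in[-\tau,0]$, $s-\bar s\le\theta\le0$, and $\tilde\nu(\theta)=\nu(\bar s-s+\theta)$ if $-\tau\le\theta<s-\bar s$. *)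

theory Defs
  imports "HOL-Analysis.Analysis"
begin

text \<open>Paths on \<open>[-\<tau>, 0]\<close> are functions on the reals, normalised by \<^const>\<open>extensional\<close> outside
  the interval, so that HOL equality is equality of paths. Right-continuity is a condition at
  \<open>\<theta> < 0\<close> only: at the right endpoint it is vacuous.\<close>

type_synonym 'n path = "real \<Rightarrow> real ^ 'n"

definition D_space :: "real \<Rightarrow> ('n::finite) path set" where
  "D_space \<tau> = {\<omega> \<in> extensional {-\<tau>..0}.
     bounded (\<omega> ` {-\<tau>..0}) \<and> (\<forall>\<theta>\<in>{-\<tau>..<0}. continuous (at_right \<theta>) \<omega>)}"

definition D_norm :: "real \<Rightarrow> ('n::finite) path \<Rightarrow> real" where
  "D_norm \<tau> \<omega> = (SUP \<theta>\<in>{-\<tau>..0}. norm (\<omega> \<theta>))"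

text \<open>The value \<open>0\<close> off the carrier only serves \<^locale>\<open>Metric_space\<close>, which wants a total
  nonnegative distance function.\<close>

definition D_dist :: "real \<Rightarrow> ('n::finite) path \<Rightarrow> 'n path \<Rightarrow> real" where
  "D_dist \<tau> \<omega> \<omega>' =
     (if \<omega> \<in> D_space \<tau> \<and> \<omega>' \<in> D_space \<tau> then D_norm \<tau> (\<omega> - \<omega>') else 0)"

definition D_topology :: "real \<Rightarrow> ('n::finite) path topology" where
  "D_topology \<tau> = Metric_space.mtopology (D_space \<tau>) (D_dist \<tau>)"

text \<open>Elements of \<^const>\<open>D_space\<close> are bounded and Borel on \<open>[-\<tau>, 0]\<close>, so for them, and for their
  differences, the integral below is a genuine one.\<close>

definition H_norm :: "real \<Rightarrow> ('n::finite) path \<Rightarrow> real" where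
  "H_norm \<tau> \<omega> = sqrt (LINT \<theta>:{-\<tau>..0}|lborel. (norm (\<omega> \<theta>))\<^sup>2)"

definition D_in :: "real \<Rightarrow> (real ^ 'n::finite) set \<Rightarrow> 'n path set" where
  "D_in \<tau> S = {\<omega> \<in> D_space \<tau>. \<forall>\<theta>\<in>{-\<tau>..0}. \<omega> \<theta> \<in> S}"

text \<open>The path component of the concatenation; meaningful for \<open>t \<le> t'\<close>.\<close>

definition paste :: "real \<Rightarrow> real \<Rightarrow> 'n path \<Rightarrow> real \<Rightarrow> 'n path \<Rightarrow> ('n::finite) path" where
  "paste \<tau> t \<omega> t' \<omega>' =
     (\<lambda>\<theta>\<in>{-\<tau>..0}. if t - t' \<le> \<theta> then \<omega>' \<theta> else \<omega> (t' - t + \<theta>))"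

type_synonym 'n state = "real \<times> 'n path \<times> real \<times> 'n path"

definition otimes :: "real \<Rightarrow> 'n state \<Rightarrow> 'n state \<Rightarrow> ('n::finite) state" where
  "otimes \<tau> = (\<lambda>(t, \<omega>, s, \<nu>) (t', \<omega>', s', \<nu>').
     (t', paste \<tau> t \<omega> t' \<omega>', s', paste \<tau> s \<nu> s' \<nu>'))"

lemma D_norm_upper:
  assumes "\<omega> \<in> D_space \<tau>" "\<omega>' \<in> D_space \<tau>" "\<theta> \<in> {-\<tau>..0}"
  shows "norm (\<omega> \<theta> - \<omega>' \<theta>) \<le> D_norm \<tau> (\<omega> - \<omega>')"
proof -
  obtain B where B: "\<And>\<theta>. \<theta> \<in> {-\<tau>..0} \<Longrightarrow> norm (\<omega> \<theta>) \<le> B"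
    using assms(1) unfolding D_space_def bounded_iff by blast
  obtain C where C: "\<And>\<theta>. \<theta> \<in> {-\<tau>..0} \<Longrightarrow> norm (\<omega>' \<theta>) \<le> C"
    using assms(2) unfolding D_space_def bounded_iff by blast
  have "norm (\<omega> \<theta> - \<omega>' \<theta>) \<le> B + C" if "\<theta> \<in> {-\<tau>..0}" for \<theta>
    using B[OF that] C[OF that] norm_triangle_ineq4[of "\<omega> \<theta>" "\<omega>' \<theta>"] by linarith
  then have "bdd_above ((\<lambda>\<theta>. norm ((\<omega> - \<omega>') \<theta>)) ` {-\<tau>..0})"
    by (intro bdd_aboveI2[where M = "B + C"]) simp
  from cSUP_upper[OF assms(3) this] show ?thesis
    by (simp add: D_norm_def)
qed

lemma Metric_space_D:
  assumes "\<tau> \<ge> 0"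
  shows "Metric_space (D_space \<tau> :: ('n::finite) path set) (D_dist \<tau>)"
proof
  fix x y z :: "'n path"
  have 0: "0 \<in> {-\<tau>..0}" using assms by simp
  then have ne: "{-\<tau>..0} \<noteq> {}" by blast
  show "0 \<le> D_dist \<tau> x y"
    using D_norm_upper[OF _ _ 0, of x y] norm_ge_zero[of "x 0 - y 0"]
    by (auto simp: D_dist_def simp del: norm_ge_zero)
  show "D_dist \<tau> x y = D_dist \<tau> y x"
    by (simp add: D_dist_def D_norm_def norm_minus_commute)
  show "D_dist \<tau> x y = 0 \<longleftrightarrow> x = y" if x: "x \<in> D_space \<tau>" and y: "y \<in> D_space \<tau>"
  proof
    assume *: "D_dist \<tau> x y = 0"
    show "x = y"
    proof (rule extensionalityI)
      show "x \<in> extensional {-\<tau>..0}" "y \<in> extensional {-\<tau>..0}"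
        using x y by (auto simp: D_space_def)
      show "x \<theta> = y \<theta>" if "\<theta> \<in> {-\<tau>..0}" for \<theta>
        using D_norm_upper[OF x y that] * x y by (simp add: D_dist_def)
    qed
  qed (use ne in \<open>simp add: D_dist_def D_norm_def\<close>)
  show "D_dist \<tau> x z \<le> D_dist \<tau> x y + D_dist \<tau> y z"
    if x: "x \<in> D_space \<tau>" and y: "y \<in> D_space \<tau>" and z: "z \<in> D_space \<tau>"
  proof -
    have "norm ((x - z) \<theta>) \<le> D_norm \<tau> (x - y) + D_norm \<tau> (y - z)" if "\<theta> \<in> {-\<tau>..0}" for \<theta>
      using D_norm_upper[OF x y that] D_norm_upper[OF y z that]
        norm_triangle_ineq[of "x \<theta> - y \<theta>" "y \<theta> - z \<theta>"] by simp
    then have "D_norm \<tau> (x - z) \<le> D_norm \<tau> (x - y) + D_norm \<tau> (y - z)"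
      unfolding D_norm_def[of \<tau> "x - z"] by (rule cSUP_least[OF ne])
    then show ?thesis using x y z by (simp add: D_dist_def)
  qed
qed

end

theory Submission
  imports Defs
begin

text \<open>Extend the initial state greedily, each time coming within \<open>(1/2) ^ n\<close> of the supremum of \<open>v\<close>
  over all extensions. The times increase to limits and the histories glue to a limit path, whose
  value at \<open>0\<close> is free (right-continuity is vacuous there) and is taken to be a cluster point of the
  current values in the compact set \<open>closure Q\<close>. The glued paths are time shifts of the limit path,
  and a right-continuous function has only countably many discontinuities, so the paths converge
  almost everywhere, hence in \<open>H\<close>. Thus \<open>v\<close> passes to the limit, which extends every state of the
  sequence and therefore attains the supremum over its own extensions.\<close>

section \<open>Discontinuities of right-continuous functions\<close>

text \<open>A rational picked from the gap to the right of each point determines the point: for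
  \<open>x < y\<close> in \<open>A\<close>, the number picked for \<open>x\<close> lies below
  \<open>x + d x \<le> y\<close>, the one picked for \<open>y\<close> above
  \<open>y\<close>.\<close>

lemma countable_right_isolated:
  fixes A :: "real set"
  assumes "\<And>x. x \<in> A \<Longrightarrow> \<exists>d>0. A \<inter> {x<..<x + d} = {}"
  shows "countable A"
proof -
  obtain d where d: "\<And>x. x \<in> A \<Longrightarrow> d x > 0 \<and> A \<inter> {x<..<x + d x} = {}"
    using assms by metis
  have "\<exists>q\<in>\<rat>. x < q \<and> q < x + d x" if "x \<in> A" for x
    using d[OF that] by (intro Rats_dense_in_real) auto
  then obtain q where q: "\<And>x. x \<in> A \<Longrightarrow> q x \<in> \<rat> \<and> x < q x \<and> q x < x + d x"
    by metis
  have less: "q x \<noteq> q y" if "x \<in> A" "y \<in> A" "x < y" for x y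
  proof
    assume "q x = q y"
    then have "y \<in> {x<..<x + d x}"
      using q[OF that(1)] q[OF that(2)] that(3) by auto
    then show False
      using d[OF that(1)] that(2) by blast
  qed
  then have "inj_on q A"
    by (metis inj_onI linorder_less_linear)
  moreover have "countable (q ` A)"
    using q by (intro countable_subset[OF _ countable_rat]) auto
  ultimately show ?thesis
    using countable_image_inj_on by blast
qed

text \<open>A discontinuity belongs to some \<open>A n\<close>, where no neighbourhood keeps the
  values within \<open>1 / Suc n\<close> of \<open>f x\<close>. Just to the right of such a point
  all values are close to \<open>f x\<close>, hence to each other, so no further point of
  \<open>A n\<close> lies there and \<open>countable_right_isolated\<close> applies.\<close>

lemma countable_right_continuous_discont:
  fixes f :: "real \<Rightarrow> 'a::metric_space"
  shows "countable {x. continuous (at_right x) f \<and> \<not> isCont f x}"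
proof -
  define A where "A = (\<lambda>n. {x. continuous (at_right x) f \<and>
    \<not> (\<exists>d>0. \<forall>y. dist y x < d \<longrightarrow> dist (f y) (f x) < 1 / Suc n)})"
  have "countable (A n)" for n
  proof (rule countable_right_isolated)
    fix x assume "x \<in> A n"
    then have "(f \<longlongrightarrow> f x) (at_right x)"
      by (simp add: A_def continuous_within)
    \<comment> \<open>Half the tolerance, because two values to the right of \<open>x\<close> are
      compared through \<open>f x\<close>.\<close>
    then have "eventually (\<lambda>y. dist (f y) (f x) < 1 / Suc n / 2) (at_right x)"
      by (rule tendstoD) simp
    then obtain b where b: "b > x" "\<And>y. x < y \<Longrightarrow> y < b \<Longrightarrow> dist (f y) (f x) < 1 / Suc n / 2"
      unfolding eventually_at_right_field by blast
    have "y \<notin> A n" if y: "x < y" "y < b" for y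
    proof -
      have "dist (f z) (f y) < 1 / Suc n" if "dist z y < min (y - x) (b - y)" for z
      proof -
        have "x < z" "z < b" using that by (auto simp: dist_real_def abs_if split: if_splits)
        then show ?thesis
          using b(2)[of z] b(2)[of y] y dist_triangle2[of "f z" "f y" "f x"] by linarith
      qed
      moreover have "min (y - x) (b - y) > 0" using y by simp
      ultimately show ?thesis unfolding A_def by blast
    qed
    then have "A n \<inter> {x<..<x + (b - x)} = {}" by auto
    then show "\<exists>d>0. A n \<inter> {x<..<x + d} = {}"
      using b(1) by (intro exI[of _ "b - x"]) simp
  qed
  moreover have "{x. continuous (at_right x) f \<and> \<not> isCont f x} \<subseteq> (\<Union>n. A n)"
  proof
    fix x assume x: "x \<in> {x. continuous (at_right x) f \<and> \<not> isCont f x}"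
    then obtain e where e: "e > 0" "\<not> (\<exists>d>0. \<forall>y. dist y x < d \<longrightarrow> dist (f y) (f x) < e)"
      unfolding continuous_at_eps_delta by auto
    obtain n where n: "1 / Suc n < e"
      using e(1) nat_approx_posE by blast
    have "x \<in> A n"
      using x e(2) n unfolding A_def by (auto) (meson less_trans)
    then show "x \<in> (\<Union>n. A n)" by blast
  qed
  ultimately show ?thesis
    by (meson countable_UN countable_subset countableI_type)
qed

text \<open>A path is constantly \<open>undefined\<close> off its interval, so right-continuity
  extends to the whole line; only at 0 may the path jump to \<open>undefined\<close> on the right.
  This makes results about functions on all reals available.\<close>

lemma D_space_right_continuous:
  assumes "x \<in> D_space \<tau>" "\<theta> \<noteq> 0"
  shows "continuous (at_right \<theta>) x"
proof -
  consider "\<theta> \<in> {-\<tau>..<0}" | "\<theta> < -\<tau>" | "\<theta> > 0"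
    using assms(2) by force
  then show ?thesis
  proof cases
    case 1
    then show ?thesis using assms(1) by (simp add: D_space_def)
  next
    case 2
    have "eventually (\<lambda>\<eta>. x \<eta> = undefined) (at_right \<theta>)"
      unfolding eventually_at_right_field using 2 assms(1)
      by (intro exI[of _ "-\<tau>"]) (auto simp: D_space_def extensional_def)
    moreover have "x \<theta> = undefined"
      using 2 assms(1) by (auto simp: D_space_def extensional_def)
    ultimately show ?thesis
      by (simp add: continuous_within tendsto_eventually)
  next
    case 3
    have "eventually (\<lambda>\<eta>. x \<eta> = undefined) (at_right \<theta>)"
      unfolding eventually_at_right_field using 3 assms(1)
      by (intro exI[of _ "\<theta> + 1"]) (auto simp: D_space_def extensional_def)
    moreover have "x \<theta> = undefined"
      using 3 assms(1) by (auto simp: D_space_def extensional_def)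
    ultimately show ?thesis
      by (simp add: continuous_within tendsto_eventually)
  qed
qed

lemma countable_D_space_discont:
  assumes "x \<in> D_space \<tau>"
  shows "countable {\<theta>. \<not> isCont x \<theta>}"
proof (rule countable_subset)
  show "{\<theta>. \<not> isCont x \<theta>} \<subseteq> insert 0 {\<theta>. continuous (at_right \<theta>) x \<and> \<not> isCont x \<theta>}"
    using D_space_right_continuous[OF assms] by auto
  show "countable (insert 0 {\<theta>. continuous (at_right \<theta>) x \<and> \<not> isCont x \<theta>})"
    using countable_right_continuous_discont by simp
qed

lemma D_space_borel_measurable:
  assumes "x \<in> D_space \<tau>"
  shows "x \<in> borel_measurable borel"
  by (rule borel_measurable_continuous_countable_exceptions[OF countable_D_space_discont[OF assms]])
    (auto intro!: continuous_at_imp_continuous_on)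

section \<open>Bounds and limits for the \<open>H\<close> norm\<close>

lemma H_norm_nonneg: "H_norm \<tau> \<omega> \<ge> 0"
  unfolding H_norm_def set_lebesgue_integral_def
  by (intro real_sqrt_ge_zero integral_nonneg_AE AE_I2) auto

lemma H_norm_le:
  assumes "\<tau> \<ge> 0" "B \<ge> 0" and B: "\<And>\<theta>. \<theta> \<in> {-\<tau>..0} \<Longrightarrow> norm (\<omega> \<theta>) \<le> B"
  shows "H_norm \<tau> \<omega> \<le> sqrt (\<tau> * B\<^sup>2)"
proof -
  have "(LINT \<theta>:{-\<tau>..0}|lborel. (norm (\<omega> \<theta>))\<^sup>2) \<le> (LINT \<theta>:{-\<tau>..0}|lborel. B\<^sup>2)"
    unfolding set_lebesgue_integral_def
    using assms by (intro integral_mono' integrable_scaleR_left)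
      (auto simp: power_mono split: split_indicator)
  also have "\<dots> = \<tau> * B\<^sup>2"
    using assms(1) by (simp add: set_lebesgue_integral_def)
  finally show ?thesis unfolding H_norm_def by simp
qed

text \<open>Dominated convergence: the constant \<open>B\<^sup>2\<close> is integrable on a bounded
  interval, and a countable exceptional set is null. The set \<open>S\<close> leaves room for the
  discontinuities of a limit path.\<close>

lemma H_norm_tendsto_0:
  assumes meas: "\<And>n. \<omega> n \<in> borel_measurable borel"
    and B: "\<And>n \<theta>. \<theta> \<in> {-\<tau>..0} \<Longrightarrow> norm (\<omega> n \<theta>) \<le> B"
    and S: "countable S" and lim: "\<And>\<theta>. \<theta> \<in> {-\<tau>..0} - S \<Longrightarrow> (\<lambda>n. \<omega> n \<theta>) \<longlonglongrightarrow> 0"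
  shows "(\<lambda>n. H_norm \<tau> (\<omega> n)) \<longlonglongrightarrow> 0"
proof -
  note [measurable] = meas
  have "(\<lambda>n. LINT \<theta>|lborel. indicator {-\<tau>..0} \<theta> *\<^sub>R (norm (\<omega> n \<theta>))\<^sup>2)
    \<longlonglongrightarrow> (LINT (\<theta>::real)|lborel. (0::real))"
  proof (rule integral_dominated_convergence[where w = "\<lambda>\<theta>. indicator {-\<tau>..0} \<theta> *\<^sub>R B\<^sup>2"])
    have "AE \<theta> in lborel. \<theta> \<notin> S"
      using S by (simp add: AE_not_in countable_imp_null_set_lborel)
    then show "AE \<theta> in lborel. (\<lambda>n. indicator {-\<tau>..0} \<theta> *\<^sub>R (norm (\<omega> n \<theta>))\<^sup>2) \<longlonglongrightarrow> 0"
    proof eventually_elim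
      case (elim \<theta>)
      show ?case
      proof (cases "\<theta> \<in> {-\<tau>..0}")
        case True
        then have "(\<lambda>n. (norm (\<omega> n \<theta>))\<^sup>2) \<longlonglongrightarrow> (norm (0 :: real ^ 'a))\<^sup>2"
          using lim elim by (intro tendsto_intros) auto
        then show ?thesis using True by simp
      qed simp
    qed
    show "AE \<theta> in lborel. norm (indicator {-\<tau>..0} \<theta> *\<^sub>R (norm (\<omega> n \<theta>))\<^sup>2)
        \<le> indicator {-\<tau>..0} \<theta> *\<^sub>R B\<^sup>2" for n
      using B by (intro AE_I2) (auto simp: indicator_def power_mono)
  qed (auto intro!: integrable_scaleR_left integrable_real_indicator
      simp: emeasure_lborel_Icc_eq)
  then have "(\<lambda>n. sqrt (LINT \<theta>|lborel. indicator {-\<tau>..0} \<theta> *\<^sub>R (norm (\<omega> n \<theta>))\<^sup>2)) \<longlonglongrightarrow> sqrt 0"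
    by (intro tendsto_intros) simp
  then show ?thesis by (simp add: H_norm_def set_lebesgue_integral_def)
qed

section \<open>Histories extending one another, and limits of chains of histories\<close>

text \<open>Right-continuity at \<theta> depends only on the values on
  \<open>{\<theta>..<b}\<close>, where \<open>f\<close> is a time shift of a path. The bound
  \<open>b + c \<le> 0\<close> keeps the shifted point strictly below 0, the one place where a path
  may fail to be right-continuous.\<close>

lemma right_continuous_shift:
  fixes x :: "('n::finite) path"
  assumes x: "x \<in> D_space \<tau>" and "\<theta> \<ge> -\<tau>" "c \<ge> 0" "\<theta> < b" "b + c \<le> 0"
    and eq: "\<And>\<eta>. \<theta> \<le> \<eta> \<Longrightarrow> \<eta> < b \<Longrightarrow> f \<eta> = x (c + \<eta>)"
  shows "continuous (at_right \<theta>) f"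
proof -
  have "continuous (at_right (\<theta> + c)) x"
    using assms by (intro D_space_right_continuous[OF x]) auto
  then have "(x \<longlongrightarrow> x (\<theta> + c)) (filtermap (\<lambda>\<eta>. \<eta> + c) (at_right \<theta>))"
    using filtermap_at_right_shift[of "-c" \<theta>] by (simp add: continuous_within)
  then have "((\<lambda>\<eta>. x (\<eta> + c)) \<longlongrightarrow> x (\<theta> + c)) (at_right \<theta>)"
    by (simp add: filterlim_filtermap)
  moreover have "eventually (\<lambda>\<eta>. x (\<eta> + c) = f \<eta>) (at_right \<theta>)"
    unfolding eventually_at_right_field using assms(4) eq
    by (intro exI[of _ b]) (auto simp: add.commute)
  ultimately show ?thesis
    using eq[of \<theta>] assms(4) by (simp add: continuous_within add.commute tendsto_cong)
qed

text \<open>In absolute time, \<theta> stands for \<open>t' + \<theta>\<close> in \<open>x'\<close>,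
  and the two histories agree strictly before \<open>t\<close>. The value of \<open>x'\<close> at
  time \<open>t\<close> is left free, as in \<open>paste\<close>, so even with \<open>t = t'\<close>
  the current value can be replaced. For \<open>t \<le> t'\<close> and \<open>x'\<close> in
  \<open>D_space\<close> this amounts to \<open>paste \<tau> t x t' x' = x'\<close>, in a form that
  shows transitivity.\<close>

definition path_ext :: "real \<Rightarrow> real \<Rightarrow> ('n::finite) path \<Rightarrow> real \<Rightarrow> 'n path \<Rightarrow> bool" where
  "path_ext \<tau> t x t' x' \<longleftrightarrow>
     t \<le> t' \<and> (\<forall>\<theta>\<in>{-\<tau>..0}. \<theta> < t - t' \<longrightarrow> x' \<theta> = x (t' - t + \<theta>))"

lemma path_extD:
  assumes "path_ext \<tau> t x t' x'" "-\<tau> \<le> \<theta>" "\<theta> < t - t'"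
  shows "x' \<theta> = x (t' - t + \<theta>)"
  using assms by (auto simp: path_ext_def)

lemma path_ext_le: "path_ext \<tau> t x t' x' \<Longrightarrow> t \<le> t'"
  by (simp add: path_ext_def)

lemma path_ext_refl: "path_ext \<tau> t x t x"
  by (simp add: path_ext_def)

lemma path_ext_trans:
  assumes "path_ext \<tau> t x t' x'" "path_ext \<tau> t' x' t'' x''"
  shows "path_ext \<tau> t x t'' x''"
proof -
  have "x'' \<theta> = x (t'' - t + \<theta>)" if "-\<tau> \<le> \<theta>" "\<theta> < t - t''" for \<theta>
    using path_extD[OF assms(2), of \<theta>] path_extD[OF assms(1), of "t'' - t' + \<theta>"]
      path_ext_le[OF assms(1)] path_ext_le[OF assms(2)] that by (simp add: algebra_simps)
  then show ?thesis
    using path_ext_le[OF assms(1)] path_ext_le[OF assms(2)] by (auto simp: path_ext_def)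
qed

lemma path_ext_paste: "t \<le> t' \<Longrightarrow> path_ext \<tau> t x t' (paste \<tau> t x t' x')"
  by (auto simp: path_ext_def paste_def)

lemma paste_eq_path_ext:
  assumes "path_ext \<tau> t x t' x'" "x' \<in> D_space \<tau>"
  shows "paste \<tau> t x t' x' = x'"
proof (rule extensionalityI)
  show "paste \<tau> t x t' x' \<in> extensional {-\<tau>..0}" by (simp add: paste_def)
  show "x' \<in> extensional {-\<tau>..0}" using assms(2) by (simp add: D_space_def)
qed (use path_extD[OF assms(1)] in \<open>auto simp: paste_def\<close>)

lemma D_inI:
  assumes "bounded K" "x \<in> extensional {-\<tau>..0}" "\<And>\<theta>. -\<tau> \<le> \<theta> \<Longrightarrow> \<theta> \<le> 0 \<Longrightarrow> x \<theta> \<in> K"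
    "\<And>\<theta>. -\<tau> \<le> \<theta> \<Longrightarrow> \<theta> < 0 \<Longrightarrow> continuous (at_right \<theta>) x"
  shows "x \<in> D_in \<tau> K"
proof -
  have "x ` {-\<tau>..0} \<subseteq> K" using assms(3) by auto
  then have "bounded (x ` {-\<tau>..0})" by (rule bounded_subset[OF assms(1)])
  then show ?thesis using assms by (auto simp: D_in_def D_space_def)
qed

text \<open>The glued path may jump at the seam \<open>t - t'\<close>, but the seam belongs to the
  newer piece, so right-continuity there concerns \<open>x'\<close> alone.\<close>

lemma paste_in_D_in:
  fixes x x' :: "('n::finite) path"
  assumes K: "bounded K" and x: "x \<in> D_in \<tau> K" and x': "x' \<in> D_in \<tau> K" and le: "t \<le> t'"
  shows "paste \<tau> t x t' x' \<in> D_in \<tau> K"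
proof (rule D_inI[OF K])
  show "paste \<tau> t x t' x' \<in> extensional {-\<tau>..0}" by (simp add: paste_def)
  show "paste \<tau> t x t' x' \<theta> \<in> K" if "-\<tau> \<le> \<theta>" "\<theta> \<le> 0" for \<theta>
    using that x x' le by (auto simp: paste_def D_in_def)
  show "continuous (at_right \<theta>) (paste \<tau> t x t' x')" if \<theta>: "-\<tau> \<le> \<theta>" "\<theta> < 0" for \<theta>
  proof (cases "\<theta> < t - t'")
    case True
    show ?thesis
      by (rule right_continuous_shift[of x \<tau> \<theta> "t' - t" "t - t'"])
        (use True x le \<theta> in \<open>auto simp: D_in_def paste_def\<close>)
  next
    case False
    show ?thesis
      by (rule right_continuous_shift[of x' \<tau> \<theta> 0 0])
        (use False x' le \<theta> in \<open>auto simp: D_in_def paste_def\<close>)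
  qed
qed

text \<open>Each \<theta> < 0 corresponds to the absolute time \<open>t' + \<theta>\<close>, which
  some \<open>t n\<close> exceeds, so the chain fixes the limit history there and leaves only the
  value at 0 to choose. For \<open>-\<tau> < \<theta> < 0\<close> and large \<open>n\<close>,
  \<open>x n \<theta>\<close> is the value of \<open>x'\<close> at \<theta> shifted by
  \<open>t n - t'\<close>, which gives convergence wherever \<open>x'\<close> is continuous.\<close>

lemma path_ext_limit:
  fixes x :: "nat \<Rightarrow> ('n::finite) path"
  assumes K: "bounded K" and \<tau>: "\<tau> > 0" and x: "\<And>n. x n \<in> D_in \<tau> K"
    and ext: "\<And>n. path_ext \<tau> (t n) (x n) (t (Suc n)) (x (Suc n))"
    and lim: "t \<longlonglongrightarrow> t'" and a: "a \<in> K"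
  obtains x' where "x' \<in> D_in \<tau> K" "x' 0 = a" "\<And>n. path_ext \<tau> (t n) (x n) t' x'"
    "(\<lambda>n. H_norm \<tau> (x n - x')) \<longlonglongrightarrow> 0"
proof -
  have mono: "path_ext \<tau> (t m) (x m) (t n) (x n)" if "m \<le> n" for m n
    using that by (induction rule: dec_induct) (auto intro: path_ext_refl path_ext_trans ext)
  have le: "t n \<le> t'" for n
    using lim path_ext_le[OF mono] by (intro incseq_le) (auto simp: incseq_def)
  have ex: "\<exists>n. \<theta> < t n - t'" if "\<theta> < 0" for \<theta>
  proof -
    have "eventually (\<lambda>n. t' + \<theta> < t n) sequentially"
      using lim that by (intro order_tendstoD(1)) auto
    then show ?thesis by (auto simp: eventually_sequentially algebra_simps)
  qed
  \<comment> \<open>The least index is merely a choice: by \<open>mono\<close> every index with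
    \<open>\<theta> < t n - t'\<close> gives the same value, which is \<open>x'_eq\<close>.\<close>
  define N where "N = (\<lambda>\<theta>. LEAST n. \<theta> < t n - t')"
  define x' where "x' = (\<lambda>\<theta>\<in>{-\<tau>..0}. if \<theta> = 0 then a else x (N \<theta>) (t' - t (N \<theta>) + \<theta>))"
  have x'_eq: "x' \<theta> = x n (t' - t n + \<theta>)" if \<theta>: "-\<tau> \<le> \<theta>" "\<theta> < t n - t'" for n \<theta>
  proof -
    have "\<theta> < t (N \<theta>) - t'" "N \<theta> \<le> n"
      unfolding N_def using \<theta> by (auto intro: LeastI Least_le)
    then have "x n (t' - t n + \<theta>) = x (N \<theta>) (t' - t (N \<theta>) + \<theta>)"
      using path_extD[OF mono[of "N \<theta>" n], of "t' - t n + \<theta>"] \<theta> le[of n]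
      by (simp add: algebra_simps)
    then show ?thesis using \<theta> le[of n] by (auto simp: x'_def)
  qed
  have ext': "path_ext \<tau> (t n) (x n) t' x'" for n
    using le[of n] x'_eq[of _ n] by (auto simp: path_ext_def)
  have x': "x' \<in> D_in \<tau> K"
  proof (rule D_inI[OF K])
    show "x' \<in> extensional {-\<tau>..0}" by (simp add: x'_def)
    fix \<theta> assume \<theta>: "-\<tau> \<le> \<theta>"
    show "x' \<theta> \<in> K" if "\<theta> \<le> 0"
    proof (cases "\<theta> = 0")
      case False
      with that obtain n where n: "\<theta> < t n - t'" using ex by force
      then show ?thesis
        using x'_eq[OF \<theta> n] x[of n] \<theta> le[of n] by (auto simp: D_in_def)
    qed (use a \<tau> in \<open>simp add: x'_def\<close>)
    assume "\<theta> < 0"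
    then obtain n where n: "\<theta> < t n - t'" using ex by force
    show "continuous (at_right \<theta>) x'"
      by (rule right_continuous_shift[of "x n" \<tau> \<theta> "t' - t n" "t n - t'"])
        (use \<theta> n le[of n] x[of n] x'_eq[of _ n] in \<open>auto simp: D_in_def\<close>)
  qed
  have xD: "x n \<in> D_space \<tau>" for n using x[of n] by (simp add: D_in_def)
  have x'D: "x' \<in> D_space \<tau>" using x' by (simp add: D_in_def)
  obtain B where B: "\<And>z. z \<in> K \<Longrightarrow> norm z \<le> B"
    using K unfolding bounded_iff by blast
  \<comment> \<open>At \<open>-\<tau>\<close> the shifted argument can stay below the interval, and
    at 0 the histories do not determine \<open>x'\<close>; both points join the exceptional
    set.\<close>
  have "(\<lambda>n. H_norm \<tau> (x n - x')) \<longlonglongrightarrow> 0"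
  proof (rule H_norm_tendsto_0[where B = "2 * B" and S = "{\<theta>. \<not> isCont x' \<theta>} \<union> {-\<tau>, 0}"])
    show "x n - x' \<in> borel_measurable borel" for n
      using D_space_borel_measurable[OF xD[of n]] D_space_borel_measurable[OF x'D]
      unfolding fun_diff_def by (rule borel_measurable_diff)
    show "norm ((x n - x') \<theta>) \<le> 2 * B" if "\<theta> \<in> {-\<tau>..0}" for n \<theta>
    proof -
      have "norm (x n \<theta>) \<le> B" "norm (x' \<theta>) \<le> B"
        using that x[of n] x' by (auto intro!: B simp: D_in_def)
      then show ?thesis using norm_triangle_ineq4[of "x n \<theta>" "x' \<theta>"] by simp
    qed
    show "countable ({\<theta>. \<not> isCont x' \<theta>} \<union> {-\<tau>, 0})"
      using countable_D_space_discont[OF x'D] by simp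
    fix \<theta> assume "\<theta> \<in> {-\<tau>..0} - ({\<theta>. \<not> isCont x' \<theta>} \<union> {-\<tau>, 0})"
    then have \<theta>: "-\<tau> < \<theta>" "\<theta> < 0" "isCont x' \<theta>" by auto
    have *: "(\<lambda>n. \<theta> + (t n - t')) \<longlonglongrightarrow> \<theta> + (t' - t')"
      using lim by (intro tendsto_intros)
    then have "(\<lambda>n. x' (\<theta> + (t n - t'))) \<longlonglongrightarrow> x' \<theta>"
      using \<theta>(3) by (intro isCont_tendsto_compose[of \<theta> x']) auto
    moreover have "eventually (\<lambda>n. -\<tau> < \<theta> + (t n - t')) sequentially"
      using * \<theta>(1) by (intro order_tendstoD(1)[OF *]) auto
    then have "eventually (\<lambda>n. x' (\<theta> + (t n - t')) = x n \<theta>) sequentially"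
    proof eventually_elim
      case (elim n)
      then show ?case
        using x'_eq[of "\<theta> + (t n - t')" n] \<theta>(2) by (simp add: algebra_simps)
    qed
    ultimately have "(\<lambda>n. x n \<theta>) \<longlonglongrightarrow> x' \<theta>"
      by (rule Lim_transform_eventually)
    then show "(\<lambda>n. (x n - x') \<theta>) \<longlonglongrightarrow> 0"
      by (simp add: LIM_zero)
  qed
  moreover have "x' 0 = a" using \<tau> by (simp add: x'_def)
  ultimately show ?thesis using that x' ext' by blast
qed

section \<open>Extensions of states, and the behaviour of \<open>v\<close> on them\<close>

text \<open>For bounded \<open>K\<close> and a state \<open>z\<close> with paths in
  \<open>D_in \<tau> K\<close>, these are exactly the concatenations of \<open>z\<close> with
  admissible states: each such concatenation is one, and each extension \<open>z'\<close> satisfies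
  \<open>otimes \<tau> z z' = z'\<close>. The lower time bounds come from
  \<open>path_ext\<close>.\<close>

definition extensions ::
    "real \<Rightarrow> real \<Rightarrow> (real ^ 'n) set \<Rightarrow> 'n state \<Rightarrow> ('n::finite) state set" where
  "extensions \<tau> T K = (\<lambda>(t, x, s, y). {(t', x', s', y').
     t' \<le> T \<and> s' \<le> T \<and> x' \<in> D_in \<tau> K \<and> y' \<in> D_in \<tau> K \<and>
     path_ext \<tau> t x t' x' \<and> path_ext \<tau> s y s' y'})"

lemma extensions_trans:
  "z' \<in> extensions \<tau> T K z \<Longrightarrow> z'' \<in> extensions \<tau> T K z' \<Longrightarrow> z'' \<in> extensions \<tau> T K z"
  by (auto simp: extensions_def intro: path_ext_trans)

lemma otimes_eq_extension:
  "z' \<in> extensions \<tau> T K z \<Longrightarrow> otimes \<tau> z z' = z'"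
  by (auto simp: extensions_def otimes_def D_in_def paste_eq_path_ext)

lemma otimes_in_extensions:
  assumes "bounded K" "x \<in> D_in \<tau> K" "y \<in> D_in \<tau> K" "x' \<in> D_in \<tau> K" "y' \<in> D_in \<tau> K"
    "t' \<in> {t..T}" "s' \<in> {s..T}"
  shows "otimes \<tau> (t, x, s, y) (t', x', s', y') \<in> extensions \<tau> T K (t, x, s, y)"
  using assms by (auto simp: extensions_def otimes_def path_ext_paste paste_in_D_in)

text \<open>Paths with values in a bounded set have uniformly bounded \<open>H_norm\<close> and
  current value, so polynomial growth becomes a uniform bound. This makes the suprema of the greedy
  construction finite.\<close>

lemma bounded_growth_on_D_in:
  assumes "\<tau> \<ge> 0" "bounded K" "L \<ge> 0"
    and growth: "\<And>t s x y.
      \<lbrakk>t \<in> {0..T}; s \<in> {0..T}; x \<in> D_space \<tau>; y \<in> D_space \<tau>\<rbrakk> \<Longrightarrow>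
      \<bar>v (t, x, s, y)\<bar>
        \<le> L * (1 + H_norm \<tau> x + norm (x 0) + H_norm \<tau> y + norm (y 0)) ^ k"
  obtains C where "\<And>t s x y. t \<in> {0..T} \<Longrightarrow> s \<in> {0..T} \<Longrightarrow> x \<in> D_in \<tau> K \<Longrightarrow> y \<in> D_in \<tau> K
      \<Longrightarrow> v (t, x, s, y) \<le> C"
proof -
  obtain B where B: "B > 0" "\<And>z. z \<in> K \<Longrightarrow> norm z \<le> B"
    using assms(2) unfolding bounded_pos by blast
  have H: "H_norm \<tau> x \<le> sqrt (\<tau> * B\<^sup>2)" "norm (x 0) \<le> B" if "x \<in> D_in \<tau> K" for x
    using that assms(1) B by (auto simp: D_in_def intro!: H_norm_le)
  show ?thesis
  proof (rule that)
    fix t s x y assume *: "t \<in> {0..T}" "s \<in> {0..T}" "x \<in> D_in \<tau> K" "y \<in> D_in \<tau> K"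
    have "v (t, x, s, y) \<le> L * (1 + H_norm \<tau> x + norm (x 0) + H_norm \<tau> y + norm (y 0)) ^ k"
      using growth[of t s x y] * by (auto simp: D_in_def)
    also have "\<dots> \<le> L * (1 + sqrt (\<tau> * B\<^sup>2) + B + sqrt (\<tau> * B\<^sup>2) + B) ^ k"
      using H[OF *(3)] H[OF *(4)] assms(3) H_norm_nonneg[of \<tau> x] H_norm_nonneg[of \<tau> y]
      by (intro mult_left_mono power_mono add_mono) auto
    finally show "v (t, x, s, y) \<le> L * (1 + sqrt (\<tau> * B\<^sup>2) + B + sqrt (\<tau> * B\<^sup>2) + B) ^ k" .
  qed
qed

text \<open>Plain continuity in the sup norm does not suffice for this, as \<open>x n\<close> need not converge to
  \<open>x'\<close> uniformly: first replace \<open>x n\<close> by \<open>x'\<close>, then let the times converge.\<close>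

lemma tendsto_along_H_convergence:
  fixes v :: "('n::finite) state \<Rightarrow> real"
  assumes \<tau>: "\<tau> \<ge> 0" and k: "k > 0"
    and v_cont: "continuous_map
      (prod_topology (top_of_set {0..T}) (prod_topology (D_topology \<tau>)
        (prod_topology (top_of_set {0..T}) (D_topology \<tau>))))
      euclideanreal v"
    and v_diff: "\<And>t s x1 x2 y1 y2.
      \<lbrakk>t \<in> {0..T}; s \<in> {0..T}; x1 \<in> D_space \<tau>; x2 \<in> D_space \<tau>;
        y1 \<in> D_space \<tau>; y2 \<in> D_space \<tau>\<rbrakk> \<Longrightarrow>
      \<bar>v (t, x1, s, y1) - v (t, x2, s, y2)\<bar>
        \<le> L * (H_norm \<tau> (x1 - x2) + norm (x1 0 - x2 0)
             + H_norm \<tau> (y1 - y2) + norm (y1 0 - y2 0)) ^ k"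
    and x: "\<And>n. x n \<in> D_space \<tau>" "x' \<in> D_space \<tau>" "(\<lambda>n. H_norm \<tau> (x n - x')) \<longlonglongrightarrow> 0"
      "(\<lambda>n. x n 0) \<longlonglongrightarrow> x' 0"
    and y: "\<And>n. y n \<in> D_space \<tau>" "y' \<in> D_space \<tau>" "(\<lambda>n. H_norm \<tau> (y n - y')) \<longlonglongrightarrow> 0"
      "(\<lambda>n. y n 0) \<longlonglongrightarrow> y' 0"
    and t: "\<And>n. t n \<in> {0..T}" "t \<longlonglongrightarrow> t'"
    and s: "\<And>n. s n \<in> {0..T}" "s \<longlonglongrightarrow> s'"
  shows "(\<lambda>n. v (t n, x n, s n, y n)) \<longlonglongrightarrow> v (t', x', s', y')"
proof -
  have top: "topspace (D_topology \<tau> :: 'n path topology) = D_space \<tau>"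
    unfolding D_topology_def using Metric_space.topspace_mtopology[OF Metric_space_D[OF \<tau>]] .
  \<comment> \<open>Freezing the two paths embeds the square of times continuously into the domain
    of \<open>v\<close>, which reduces the product topology to ordinary continuity on a subset of
    the plane.\<close>
  have "continuous_map (prod_topology (top_of_set {0..T}) (top_of_set {0..T}))
      (prod_topology (top_of_set {0..T}) (prod_topology (D_topology \<tau>)
        (prod_topology (top_of_set {0..T}) (D_topology \<tau>))))
      (\<lambda>p. (fst p, x', snd p, y'))"
    using x(2) y(2)
    by (intro continuous_map_pairedI continuous_map_fst continuous_map_snd)
      (auto simp: top)
  from continuous_map_compose[OF this v_cont]
  have cont: "continuous_on ({0..T} \<times> {0..T}) (\<lambda>p. v (fst p, x', snd p, y'))"
    by (simp add: o_def prod_topology_subtopology_eu)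
  have "t' \<in> {0..T}" "s' \<in> {0..T}"
    using closed_sequentially[of "{0..T}" t t'] closed_sequentially[of "{0..T}" s s'] t s
    by simp_all
  moreover have "(\<lambda>n. (t n, s n)) \<longlonglongrightarrow> (t', s')"
    using t s by (intro tendsto_intros)
  ultimately have "(\<lambda>n. v (t n, x', s n, y')) \<longlonglongrightarrow> v (t', x', s', y')"
    using continuous_on_tendsto_compose[OF cont, of "\<lambda>n. (t n, s n)" "(t', s')" sequentially] t s
    by simp
  moreover have "(\<lambda>n. v (t n, x n, s n, y n) - v (t n, x', s n, y')) \<longlonglongrightarrow> 0"
  proof (rule Lim_null_comparison)
    have "(\<lambda>n. L * (H_norm \<tau> (x n - x') + norm (x n 0 - x' 0)
        + H_norm \<tau> (y n - y') + norm (y n 0 - y' 0)) ^ k)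
      \<longlonglongrightarrow> L * (0 + norm (x' 0 - x' 0) + 0 + norm (y' 0 - y' 0)) ^ k"
      using x y by (intro tendsto_intros)
    \<comment> \<open>Here \<open>k > 0\<close> enters: it makes the power of the base 0
      vanish.\<close>
    then show "(\<lambda>n. L * (H_norm \<tau> (x n - x') + norm (x n 0 - x' 0)
        + H_norm \<tau> (y n - y') + norm (y n 0 - y' 0)) ^ k) \<longlonglongrightarrow> 0"
      using k by (simp add: zero_power)
    show "eventually (\<lambda>n. norm (v (t n, x n, s n, y n) - v (t n, x', s n, y'))
        \<le> L * (H_norm \<tau> (x n - x') + norm (x n 0 - x' 0)
        + H_norm \<tau> (y n - y') + norm (y n 0 - y' 0)) ^ k) sequentially"
      using v_diff x y t s by (intro always_eventually) simp
  qed
  ultimately show ?thesis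
    using tendsto_add by fastforce
qed

section \<open>The greedy sequence and its limit\<close>

theorem lemma4p1:
  fixes T \<tau> L :: real and k :: nat
    and Q :: "(real ^ 'n::finite) set"
    and v :: "'n state \<Rightarrow> real"
  assumes T: "T > 0" and \<tau>: "\<tau> > 0"
    and Q: "open Q" "bounded Q"
    and v_cont: "continuous_map
      (prod_topology (top_of_set {0..T}) (prod_topology (D_topology \<tau>)
        (prod_topology (top_of_set {0..T}) (D_topology \<tau>))))
      euclideanreal v"
    and L: "L > 0" and k: "k > 0"
    and v_growth: "\<And>t s x y.
      \<lbrakk>t \<in> {0..T}; s \<in> {0..T}; x \<in> D_space \<tau>; y \<in> D_space \<tau>\<rbrakk> \<Longrightarrow>
      \<bar>v (t, x, s, y)\<bar>
        \<le> L * (1 + H_norm \<tau> x + norm (x 0) + H_norm \<tau> y + norm (y 0)) ^ k"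
    and v_diff: "\<And>t s x1 x2 y1 y2.
      \<lbrakk>t \<in> {0..T}; s \<in> {0..T}; x1 \<in> D_space \<tau>; x2 \<in> D_space \<tau>;
        y1 \<in> D_space \<tau>; y2 \<in> D_space \<tau>\<rbrakk> \<Longrightarrow>
      \<bar>v (t, x1, s, y1) - v (t, x2, s, y2)\<bar>
        \<le> L * (H_norm \<tau> (x1 - x2) + norm (x1 0 - x2 0)
             + H_norm \<tau> (y1 - y2) + norm (y1 0 - y2 0)) ^ k"
    and init: "t0 \<in> {0..T}" "x0 \<in> D_in \<tau> (closure Q)"
      "s0 \<in> {0..T}" "y0 \<in> D_in \<tau> (closure Q)"
  shows "\<exists>t' \<in> {t0..T}. \<exists>x' \<in> D_in \<tau> (closure Q). \<exists>s' \<in> {s0..T}. \<exists>y' \<in> D_in \<tau> (closure Q).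
      (t', x', s', y') = otimes \<tau> (t0, x0, s0, y0) (t', x', s', y') \<and>
      v (t', x', s', y') \<ge> v (t0, x0, s0, y0) \<and>
      ereal (v (t', x', s', y')) =
        (SUP (t, x, s, y) \<in> {t'..T} \<times> D_in \<tau> (closure Q) \<times> {s'..T} \<times> D_in \<tau> (closure Q).
          ereal (v (otimes \<tau> (t', x', s', y') (t, x, s, y))))"
proof -
  define K where "K = closure Q"
  have K: "bounded K" "closed K" using Q by (auto simp: K_def)
  define E where "E = extensions \<tau> T K"
  define z0 where "z0 = (t0, x0, s0, y0)"
  have z0: "z0 \<in> E z0"
    using init by (auto simp: E_def z0_def extensions_def K_def path_ext_refl)
  have E_trans: "z'' \<in> E z" if "z' \<in> E z" "z'' \<in> E z'" for z z' z''
    using that extensions_trans unfolding E_def by blast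
  obtain C where C: "\<And>t s x y. t \<in> {0..T} \<Longrightarrow> s \<in> {0..T} \<Longrightarrow> x \<in> D_in \<tau> K \<Longrightarrow> y \<in> D_in \<tau> K
      \<Longrightarrow> v (t, x, s, y) \<le> C"
    using bounded_growth_on_D_in[of \<tau> K L T v k] \<tau> K L v_growth by auto
  have bdd: "v z \<le> C" if "z \<in> E z0" for z
  proof -
    obtain t x s y where z: "z = (t, x, s, y)" by (cases z)
    with that have "t \<in> {0..T}" "s \<in> {0..T}" "x \<in> D_in \<tau> K" "y \<in> D_in \<tau> K"
      using init by (auto simp: E_def z0_def extensions_def dest: path_ext_le)
    then show ?thesis using C z by blast
  qed
  \<comment> \<open>Extension is reflexive only at states within the bounds of
    \<open>extensions\<close>; being an extension of some state certifies this.\<close>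
  have E_refl: "z \<in> E z" if "z \<in> E z'" for z z'
    using that by (auto simp: E_def extensions_def path_ext_refl)
  \<comment> \<open>Closeness to the supremum alone would not make \<open>v\<close> increase. If
    \<open>z\<close> is already close, it is kept; otherwise some extension exceeds
    \<open>v z\<close> by more than \<open>(1/2) ^ n\<close>, so a state within
    \<open>(1/2) ^ n\<close> of the supremum has a larger value than \<open>z\<close>.\<close>
  have step: "\<exists>z'. z' \<in> E z0 \<and> z' \<in> E z \<and> v z \<le> v z' \<and> (\<forall>w\<in>E z. v w \<le> v z' + (1/2) ^ n)"
    if z: "z \<in> E z0" for z n
  proof (cases "\<forall>w\<in>E z. v w \<le> v z + (1/2) ^ n")
    case True
    then show ?thesis using z E_refl by blast
  next
    case False
    have bd: "bdd_above (v ` E z)"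
      by (intro bdd_aboveI2[where M = C] bdd E_trans[OF z])
    have ne: "v ` E z \<noteq> {}" using E_refl[OF z] by blast
    obtain z' where z': "z' \<in> E z" "Sup (v ` E z) - (1/2) ^ n < v z'"
      using less_cSupD[OF ne, of "Sup (v ` E z) - (1/2) ^ n"] by auto
    have up: "v w \<le> Sup (v ` E z)" if "w \<in> E z" for w
      using that bd by (intro cSup_upper) auto
    have "v z \<le> v z'" using False z' up by fastforce
    moreover have "v w \<le> v z' + (1/2) ^ n" if "w \<in> E z" for w
      using up[OF that] z'(2) by simp
    ultimately show ?thesis using z' E_trans[OF z] by blast
  qed
  \<comment> \<open>Near-optimality is measured over the extensions of \<open>f n\<close>, a set
    that contains every later state and also the extensions of the limit. The clause for
    \<open>n = 0\<close> fixes the start.\<close>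
  have "\<exists>f. \<forall>n. (f n \<in> E z0 \<and> (n = 0 \<longrightarrow> f n = z0)) \<and>
     (f (Suc n) \<in> E (f n) \<and> v (f n) \<le> v (f (Suc n)) \<and> (\<forall>w\<in>E (f n). v w \<le> v (f (Suc n)) + (1/2) ^ n))"
  proof (rule dependent_nat_choice)
    show "\<exists>z. z \<in> E z0 \<and> (0 = (0::nat) \<longrightarrow> z = z0)" using z0 by blast
  qed (use step in simp)
  then obtain f where f: "\<And>n. f n \<in> E z0" "f 0 = z0" "\<And>n. f (Suc n) \<in> E (f n)"
      "\<And>n. v (f n) \<le> v (f (Suc n))"
      "\<And>n w. w \<in> E (f n) \<Longrightarrow> v w \<le> v (f (Suc n)) + (1/2) ^ n"
    by blast
  define t x s y where "t = (\<lambda>n. fst (f n))" and "x = (\<lambda>n. fst (snd (f n)))"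
    and "s = (\<lambda>n. fst (snd (snd (f n))))" and "y = (\<lambda>n. snd (snd (snd (f n))))"
  have f_eq: "f n = (t n, x n, s n, y n)" for n
    by (simp add: t_def x_def s_def y_def)
  have tx: "t n \<in> {t0..T}" "x n \<in> D_in \<tau> K" "s n \<in> {s0..T}" "y n \<in> D_in \<tau> K" for n
    using f(1)[of n] by (auto simp: E_def extensions_def z0_def f_eq dest: path_ext_le)
  have ext: "path_ext \<tau> (t n) (x n) (t (Suc n)) (x (Suc n))"
    "path_ext \<tau> (s n) (y n) (s (Suc n)) (y (Suc n))" for n
    using f(3)[of n] by (auto simp: E_def extensions_def f_eq)
  have "incseq t" "incseq s"
    by (rule incseq_SucI, rule path_ext_le, rule ext)+
  moreover have "\<forall>n. t n \<le> T" "\<forall>n. s n \<le> T" using tx by simp_all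
  ultimately obtain t' s' where t': "t \<longlonglongrightarrow> t'" and s': "s \<longlonglongrightarrow> s'"
    by (elim incseq_convergent)
  have ts': "t' \<in> {t0..T}" "s' \<in> {s0..T}"
    using closed_sequentially[of "{t0..T}" t t'] closed_sequentially[of "{s0..T}" s s'] tx t' s'
    by simp_all
  \<comment> \<open>The chain does not control the current values, which later states may overwrite.
    Treating them as pairs gives a single subsequence for both.\<close>
  have "compact (K \<times> K)" using K by (intro compact_Times) (simp_all add: compact_eq_bounded_closed)
  moreover have "(x n 0, y n 0) \<in> K \<times> K" for n
    using tx(2)[of n] tx(4)[of n] \<tau> by (simp add: D_in_def)
  ultimately obtain l r where lr: "l \<in> K \<times> K" "strict_mono r" "((\<lambda>n. (x n 0, y n 0)) \<circ> r) \<longlonglongrightarrow> l"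
    using seq_compactE[OF compact_imp_seq_compact, of "K \<times> K" "\<lambda>n. (x n 0, y n 0)"] by blast
  obtain a b where l: "l = (a, b)" by (cases l)
  have ab: "a \<in> K" "b \<in> K" "(\<lambda>n. x (r n) 0) \<longlonglongrightarrow> a" "(\<lambda>n. y (r n) 0) \<longlonglongrightarrow> b"
    using lr(1) tendsto_fst[OF lr(3)] tendsto_snd[OF lr(3)] by (simp_all add: l o_def)
  \<comment> \<open>The histories are glued along the whole chain; the subsequence only selects the
    values \<open>a\<close> and \<open>b\<close> at 0 and later carries the convergence of
    \<open>v\<close>.\<close>
  obtain x' where x': "x' \<in> D_in \<tau> K" "x' 0 = a" "\<And>n. path_ext \<tau> (t n) (x n) t' x'"
      "(\<lambda>n. H_norm \<tau> (x n - x')) \<longlonglongrightarrow> 0"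
    by (rule path_ext_limit[OF K(1) \<tau> tx(2) ext(1) t' ab(1)]) (rule that; assumption)
  obtain y' where y': "y' \<in> D_in \<tau> K" "y' 0 = b" "\<And>n. path_ext \<tau> (s n) (y n) s' y'"
      "(\<lambda>n. H_norm \<tau> (y n - y')) \<longlonglongrightarrow> 0"
    by (rule path_ext_limit[OF K(1) \<tau> tx(4) ext(2) s' ab(2)]) (rule that; assumption)
  define z' where "z' = (t', x', s', y')"
  have z'E: "z' \<in> E (f n)" for n
    using ts' x' y' by (auto simp: z'_def E_def extensions_def f_eq)
  have "(\<lambda>n. v (t (r n), x (r n), s (r n), y (r n))) \<longlonglongrightarrow> v (t', x', s', y')"
  proof (rule tendsto_along_H_convergence[OF less_imp_le[OF \<tau>] k v_cont v_diff])
    show "(\<lambda>n. H_norm \<tau> (x (r n) - x')) \<longlonglongrightarrow> 0" "(\<lambda>n. H_norm \<tau> (y (r n) - y')) \<longlonglongrightarrow> 0"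
      "(\<lambda>n. t (r n)) \<longlonglongrightarrow> t'" "(\<lambda>n. s (r n)) \<longlonglongrightarrow> s'"
      using LIMSEQ_subseq_LIMSEQ[OF x'(4) lr(2)] LIMSEQ_subseq_LIMSEQ[OF y'(4) lr(2)]
        LIMSEQ_subseq_LIMSEQ[OF t' lr(2)] LIMSEQ_subseq_LIMSEQ[OF s' lr(2)]
      by (simp_all add: o_def)
    show "t (r n) \<in> {0..T}" "s (r n) \<in> {0..T}" for n
      using tx[of "r n"] init by auto
  qed (use tx x' y' ab in \<open>auto simp: D_in_def\<close>)
  then have lim: "(\<lambda>n. v (f (r n))) \<longlonglongrightarrow> v z'" by (simp add: f_eq z'_def)
  have inc: "incseq (\<lambda>n. v (f n))" using f(4) by (rule incseq_SucI)
  have ge: "v z0 \<le> v z'"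
    using lim incseqD[OF inc, of 0] f(2) by (intro LIMSEQ_le_const[OF lim]) auto
  have max: "v w \<le> v z'" if "w \<in> E z'" for w
  proof -
    \<comment> \<open>An extension of the limit extends every \<open>f n\<close>, which bounds
      \<open>v w\<close> through \<open>f (Suc n)\<close>. As \<open>r (Suc n)\<close> is at least
      \<open>Suc n\<close>, monotonicity moves this bound to the subsequence.\<close>
    have "v w \<le> v (f (r (Suc n))) + (1/2) ^ n" for n
      using f(5)[OF E_trans[OF z'E that], of n] incseqD[OF inc seq_suble[OF lr(2)], of "Suc n"]
      by simp
    moreover have "(\<lambda>n. v (f (r (Suc n))) + (1/2) ^ n) \<longlonglongrightarrow> v z' + 0"
      using LIMSEQ_Suc[OF lim] by (intro tendsto_add LIMSEQ_realpow_zero) auto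
    ultimately show ?thesis
      using LIMSEQ_le_const[of _ "v z' + 0" "v w"] by auto
  qed
  have otimes0: "z' = otimes \<tau> z0 z'" and otimes': "otimes \<tau> z' z' = z'"
    using otimes_eq_extension[of z' \<tau> T K] z'E[of 0] E_refl[OF z'E[of 0]] f(2)
    by (auto simp: E_def)
  let ?A = "{t'..T} \<times> D_in \<tau> K \<times> {s'..T} \<times> D_in \<tau> K"
  \<comment> \<open>The supremum is attained at \<open>z'\<close> itself, which concatenation with
    \<open>z'\<close> reproduces; every concatenation extends \<open>z'\<close> and is bounded by
    \<open>max\<close>.\<close>
  have "ereal (v z') = (SUP w\<in>?A. ereal (v (otimes \<tau> z' w)))"
  proof (rule antisym)
    have "z' \<in> ?A" using ts' x' y' by (simp add: z'_def)
    from SUP_upper[OF this, of "\<lambda>w. ereal (v (otimes \<tau> z' w))"]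
    show "ereal (v z') \<le> (SUP w\<in>?A. ereal (v (otimes \<tau> z' w)))"
      by (simp add: otimes')
    show "(SUP w\<in>?A. ereal (v (otimes \<tau> z' w))) \<le> ereal (v z')"
    proof (rule SUP_least)
      fix w assume "w \<in> ?A"
      then have "otimes \<tau> z' w \<in> E z'"
        using otimes_in_extensions[OF K(1)] x' y' by (auto simp: E_def z'_def)
      then show "ereal (v (otimes \<tau> z' w)) \<le> ereal (v z')" using max by simp
    qed
  qed
  then have sup: "ereal (v (t', x', s', y')) =
      (SUP (t, x, s, y) \<in> ?A. ereal (v (otimes \<tau> (t', x', s', y') (t, x, s, y))))"
    by (simp add: z'_def case_prod_unfold)
  have "(t', x', s', y') = otimes \<tau> (t0, x0, s0, y0) (t', x', s', y')"
    "v (t', x', s', y') \<ge> v (t0, x0, s0, y0)"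
    using otimes0 ge by (simp_all only: z0_def z'_def)
  with sup show ?thesis
    unfolding K_def[symmetric]
    by (intro bexI[of _ t'] bexI[of _ x'] bexI[of _ s'] bexI[of _ y'] conjI ts' x'(1) y'(1))
qed

end
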